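(* Let $G$ be a looped simple graph and $M$ a binary matroid. The following are equivalent: (1) $M$ is isomorphic to $M(IAS(H))$ for some graph $H$ obtained from $G$ through some sequence of local complementations (simple or non-simple), loop complementations and vertex deletions; (2) $M$ is isomorphic to a minor of $M(IAS(G))$ obtained by removing some cells of the canonical partition, each removed cell being removed by contracting one of its elements and deleting the other two.
   Context: A looped simple graph is a finite graph in which each vertex may carry at most one loop and distinct non-loop edges join distinct pairs of vertices; $N(v)$ is the set of neighbors of $v$ other than $v$. $A(G)$ is the adjacency matrix over $GF(2)$ (diagonal $1$ iff looped). $M(IAS(G))$ is the binary matroid represented by the columns of $(I\mid A(G)\mid I+A(G))$; its ground set consists of columns $v_\phi,v_\chi,v_\psi$ (the columns of $v$ in $I$, $A(G)$, $I+A(G)$), and the canonical partition has cells $\{v_\phi,v_\chi,v_\psi\}$, $v\in V(G)$. Loop complementation at $v$ reverses the loop status of $v$. The simple local complement $G^v_s$ complements all adjacencies between distinct elements of $N(v)$; the non-simple local complement $G^v_{ns}$ is obtained from $G^v_s$ by also reversing the loop status of each element of $N(v)$. *)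

theory Defs
  imports "HOL-Library.Z2" "Graph_Theory.Pair_Digraph"
begin

section \<open>Matroids\<close>

record 'a indep_system =
  ground :: "'a set"
  indep :: "'a set \<Rightarrow> bool"

locale matroid =
  fixes M :: "'a indep_system" (structure)
  assumes ground_finite: "finite (ground M)"
    and indep_subset_ground: "indep M X \<Longrightarrow> X \<subseteq> ground M"
    and indep_empty: "indep M {}"
    and indep_mono: "indep M X \<Longrightarrow> Y \<subseteq> X \<Longrightarrow> indep M Y"
    and indep_augment:
      "indep M X \<Longrightarrow> indep M Y \<Longrightarrow> card X < card Y \<Longrightarrow> \<exists>y \<in> Y - X. indep M (insert y X)"

definition matroid_delete :: "'a indep_system \<Rightarrow> 'a set \<Rightarrow> 'a indep_system" where
  "matroid_delete M D =
    \<lparr>ground = ground M - D, indep = (\<lambda>X. X \<subseteq> ground M - D \<and> indep M X)\<rparr>"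

definition basis_of :: "'a indep_system \<Rightarrow> 'a set \<Rightarrow> 'a set \<Rightarrow> bool" where
  "basis_of M X B \<longleftrightarrow> B \<subseteq> X \<and> indep M B \<and> (\<forall>x \<in> X - B. \<not> indep M (insert x B))"

text \<open>In a matroid the choice of the basis of the contracted set is immaterial.  The contracted
  set may be dependent; in particular, contracting a matroid loop amounts to deleting it.\<close>

definition matroid_contract :: "'a indep_system \<Rightarrow> 'a set \<Rightarrow> 'a indep_system" where
  "matroid_contract M C =
    \<lparr>ground = ground M - C,
     indep = (\<lambda>X. X \<subseteq> ground M - C \<and> (\<exists>B. basis_of M (ground M \<inter> C) B \<and> indep M (X \<union> B)))\<rparr>"

definition matroid_iso :: "'a indep_system \<Rightarrow> 'b indep_system \<Rightarrow> bool" where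
  "matroid_iso M N \<longleftrightarrow>
    (\<exists>f. bij_betw f (ground M) (ground N) \<and>
      (\<forall>X \<subseteq> ground M. indep M X \<longleftrightarrow> indep N (f ` X)))"

text \<open>The matroid represented over \<open>GF(2)\<close> by the matrix \<open>A\<close> with rows indexed by \<open>R\<close> and columns
  indexed by \<open>E\<close>.  Independence is that of the family of columns: equal columns with different
  indices are dependent.\<close>

definition columns_independent :: "'r set \<Rightarrow> ('r \<Rightarrow> 'e \<Rightarrow> bit) \<Rightarrow> 'e set \<Rightarrow> bool" where
  "columns_independent R A X \<longleftrightarrow>
    (\<forall>c :: 'e \<Rightarrow> bit. (\<forall>r \<in> R. (\<Sum>e \<in> X. c e * A r e) = 0) \<longrightarrow> (\<forall>e \<in> X. c e = 0))"

definition vector_matroid :: "'r set \<Rightarrow> 'e set \<Rightarrow> ('r \<Rightarrow> 'e \<Rightarrow> bit) \<Rightarrow> 'e indep_system" where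
  "vector_matroid R E A =
    \<lparr>ground = E, indep = (\<lambda>X. X \<subseteq> E \<and> columns_independent R A X)\<rparr>"

locale binary_matroid = matroid M for M :: "'a indep_system" (structure) +
  assumes representable: "\<exists>(m::nat) A. M = vector_matroid {..<m} (ground M) A"


section \<open>Local operations on looped simple graphs\<close>

text \<open>Looped simple graphs are the members of the locale \<^locale>\<open>pair_pseudo_graph\<close>: finite, with a
  symmetric set of arcs.  A non-loop edge \<open>{u, v}\<close> is the pair of arcs \<open>(u, v)\<close> and \<open>(v, u)\<close>; a
  loop at \<open>v\<close> is the arc \<open>(v, v)\<close>.\<close>

definition nbrs :: "'v pair_pre_digraph \<Rightarrow> 'v \<Rightarrow> 'v set" where
  "nbrs G v = {w. w \<noteq> v \<and> (v, w) \<in> parcs G}"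

definition toggle :: "'v pair_pre_digraph \<Rightarrow> 'v rel \<Rightarrow> 'v pair_pre_digraph" where
  "toggle G F = \<lparr>pverts = pverts G, parcs = sym_diff (parcs G) F\<rparr>"

definition loop_complement :: "'v pair_pre_digraph \<Rightarrow> 'v \<Rightarrow> 'v pair_pre_digraph" where
  "loop_complement G v = toggle G {(v, v)}"

definition simple_local_complement :: "'v pair_pre_digraph \<Rightarrow> 'v \<Rightarrow> 'v pair_pre_digraph" where
  "simple_local_complement G v = toggle G {(a, b). a \<in> nbrs G v \<and> b \<in> nbrs G v \<and> a \<noteq> b}"

definition nonsimple_local_complement :: "'v pair_pre_digraph \<Rightarrow> 'v \<Rightarrow> 'v pair_pre_digraph" where
  "nonsimple_local_complement G v =
    toggle (simple_local_complement G v) {(a, a) | a. a \<in> nbrs G v}"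

definition delete_vertex :: "'v pair_pre_digraph \<Rightarrow> 'v \<Rightarrow> 'v pair_pre_digraph" where
  "delete_vertex G v =
    \<lparr>pverts = pverts G - {v}, parcs = {(a, b) \<in> parcs G. a \<noteq> v \<and> b \<noteq> v}\<rparr>"

inductive graph_step :: "'v pair_pre_digraph \<Rightarrow> 'v pair_pre_digraph \<Rightarrow> bool" for G where
  simple: "v \<in> pverts G \<Longrightarrow> graph_step G (simple_local_complement G v)"
| nonsimple: "v \<in> pverts G \<Longrightarrow> graph_step G (nonsimple_local_complement G v)"
| loop: "v \<in> pverts G \<Longrightarrow> graph_step G (loop_complement G v)"
| delete: "v \<in> pverts G \<Longrightarrow> graph_step G (delete_vertex G v)"


section \<open>Isotropic matroids\<close>

datatype ias_block = Phi | Chi | Psi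

definition identity_matrix :: "'v \<Rightarrow> 'v \<Rightarrow> bit" where
  "identity_matrix u v = of_bool (u = v)"

definition adjacency_matrix :: "'v pair_pre_digraph \<Rightarrow> 'v \<Rightarrow> 'v \<Rightarrow> bit" where
  "adjacency_matrix G u v = of_bool ((u, v) \<in> parcs G)"

text \<open>The matrix \<open>(I | A(G) | I + A(G))\<close>; the columns of \<open>v\<close> in the three blocks are indexed by
  \<open>(v, Phi)\<close>, \<open>(v, Chi)\<close> and \<open>(v, Psi)\<close>.\<close>

fun ias_matrix :: "'v pair_pre_digraph \<Rightarrow> 'v \<Rightarrow> 'v \<times> ias_block \<Rightarrow> bit" where
  "ias_matrix G u (v, Phi) = identity_matrix u v"
| "ias_matrix G u (v, Chi) = adjacency_matrix G u v"
| "ias_matrix G u (v, Psi) = identity_matrix u v + adjacency_matrix G u v"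

definition cell :: "'v \<Rightarrow> ('v \<times> ias_block) set" where
  "cell v = {(v, Phi), (v, Chi), (v, Psi)}"

definition ias_matroid :: "'v pair_pre_digraph \<Rightarrow> ('v \<times> ias_block) indep_system" where
  "ias_matroid G = vector_matroid (pverts G) (\<Union>v \<in> pverts G. cell v) (ias_matrix G)"

text \<open>For every \<open>v \<in> W\<close> the cell of \<open>v\<close> is removed by contracting \<open>(v, t v)\<close> and deleting the
  other two elements.\<close>

definition remove_cells ::
  "('v \<times> ias_block) indep_system \<Rightarrow> 'v set \<Rightarrow> ('v \<Rightarrow> ias_block) \<Rightarrow> ('v \<times> ias_block) indep_system"
where
  "remove_cells M W t =
    matroid_delete (matroid_contract M {(v, t v) | v. v \<in> W})
      (\<Union>v \<in> W. cell v - {(v, t v)})"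

end

theory Submission
  imports Defs "HOL-Combinatorics.Transposition"
begin

text \<open>Contracting a set \<open>C\<close> in a binary matroid leaves \<open>X\<close> independent iff every linear dependency
  supported on \<open>X \<union> C\<close> vanishes on \<open>X\<close>. In these terms contracting \<open>v\<^sub>\<phi>\<close> and deleting the rest of
  its cell amounts to deleting \<open>v\<close> from the graph, while loop complementations and non-simple
  local complementations at \<open>v\<close> only transpose two elements of the cell of \<open>v\<close>. If \<open>v\<close> has a
  neighbor, these transpositions suffice to bring any element of its cell to position \<open>v\<^sub>\<phi>\<close>; if \<open>v\<close> is
  isolated, its cell is a direct summand and every way of removing it is the deletion of \<open>v\<close>.\<close>

text \<open>Otherwise \<open>+\<close> and \<open>*\<close> on \<open>bit\<close> would be rewritten
  to bitwise operations, and the ring and sum laws would no longer match.\<close>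

declare add_bit_eq_xor [simp del] mult_bit_eq_and [simp del]

lemma bit_add_self [simp]: "x + x = (0 :: bit)"
  by (cases x) simp_all

lemma bit_add_eq_0_iff: "x + y = 0 \<longleftrightarrow> x = (y :: bit)"
  by (cases x; cases y) simp_all

section \<open>Isomorphism as an equivalence relation\<close>

lemma matroid_iso_refl: "matroid_iso M M"
  unfolding matroid_iso_def by (intro exI[of _ id]) auto

lemma matroid_iso_sym:
  assumes "matroid_iso M N"
  shows "matroid_iso N M"
proof -
  from assms obtain f where f: "bij_betw f (ground M) (ground N)"
    and ind: "\<And>X. X \<subseteq> ground M \<Longrightarrow> indep M X \<longleftrightarrow> indep N (f ` X)"
    unfolding matroid_iso_def by blast
  let ?g = "inv_into (ground M) f"
  have g: "bij_betw ?g (ground N) (ground M)"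
    using f by (rule bij_betw_inv_into)
  moreover have "indep N X \<longleftrightarrow> indep M (?g ` X)" if "X \<subseteq> ground N" for X
  proof -
    have "f ` ?g ` X = X"
      using f that by (simp add: bij_betw_def image_inv_into_cancel)
    moreover have "?g ` X \<subseteq> ground M"
      using g that by (auto simp: bij_betw_def)
    ultimately show ?thesis using ind by metis
  qed
  ultimately show ?thesis unfolding matroid_iso_def by blast
qed

lemma matroid_iso_trans:
  assumes "matroid_iso M N" "matroid_iso N P"
  shows "matroid_iso M P"
proof -
  from assms(1) obtain f where f: "bij_betw f (ground M) (ground N)"
    and f_ind: "\<And>X. X \<subseteq> ground M \<Longrightarrow> indep M X \<longleftrightarrow> indep N (f ` X)"
    unfolding matroid_iso_def by blast
  from assms(2) obtain g where g: "bij_betw g (ground N) (ground P)"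
    and g_ind: "\<And>X. X \<subseteq> ground N \<Longrightarrow> indep N X \<longleftrightarrow> indep P (g ` X)"
    unfolding matroid_iso_def by blast
  have "bij_betw (g \<circ> f) (ground M) (ground P)"
    using f g by (rule bij_betw_trans)
  moreover have "indep M X \<longleftrightarrow> indep P ((g \<circ> f) ` X)" if "X \<subseteq> ground M" for X
  proof -
    have "f ` X \<subseteq> ground N" using f that by (auto simp: bij_betw_def)
    then show ?thesis using f_ind[OF that] g_ind by (simp add: image_comp)
  qed
  ultimately show ?thesis unfolding matroid_iso_def by blast
qed


section \<open>Contraction in vector matroids\<close>

text \<open>The functions are total and their values outside \<open>E\<close> are unconstrained, so
  every support condition below is stated separately.\<close>

definition null_vectors :: "'r set \<Rightarrow> 'e set \<Rightarrow> ('r \<Rightarrow> 'e \<Rightarrow> bit) \<Rightarrow> ('e \<Rightarrow> bit) set" where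
  "null_vectors R E A = {c. \<forall>r \<in> R. (\<Sum>e \<in> E. c e * A r e) = 0}"

text \<open>Extending a dependency of \<open>X\<close> by zero gives a null vector over all of
  \<open>E\<close>; thus a single linear space decides the independence of every subset.\<close>

lemma columns_independent_iff:
  assumes "finite E" "X \<subseteq> E"
  shows "columns_independent R A X \<longleftrightarrow>
    (\<forall>c \<in> null_vectors R E A. (\<forall>e. e \<notin> X \<longrightarrow> c e = 0) \<longrightarrow> (\<forall>e \<in> X. c e = 0))"
    (is "_ \<longleftrightarrow> ?R")
proof
  assume L: "columns_independent R A X"
  show ?R
  proof (intro ballI impI)
    fix c e assume c: "c \<in> null_vectors R E A" and supp: "\<forall>e. e \<notin> X \<longrightarrow> c e = 0" and e: "e \<in> X"
    have "(\<Sum>e \<in> X. c e * A r e) = (\<Sum>e \<in> E. c e * A r e)" for r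
      using assms supp by (intro sum.mono_neutral_left) auto
    then have "\<forall>r \<in> R. (\<Sum>e \<in> X. c e * A r e) = 0"
      using c by (simp add: null_vectors_def)
    then show "c e = 0" using L e unfolding columns_independent_def by blast
  qed
next
  assume R: ?R
  show "columns_independent R A X"
    unfolding columns_independent_def
  proof (intro allI impI)
    fix c :: "_ \<Rightarrow> bit" assume c: "\<forall>r \<in> R. (\<Sum>e \<in> X. c e * A r e) = 0"
    let ?d = "\<lambda>e. if e \<in> X then c e else 0"
    have "(\<Sum>e \<in> E. ?d e * A r e) = (\<Sum>e \<in> X. c e * A r e)" for r
      using assms by (intro sum.mono_neutral_cong_right) auto
    then have "?d \<in> null_vectors R E A"
      using c by (simp add: null_vectors_def)
    from bspec[OF R this] show "\<forall>e \<in> X. c e = 0"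
      by (smt (verit))
  qed
qed

text \<open>Null vectors form a linear space; this form serves to eliminate many entries at once by
  adding circuits.\<close>

lemma null_vectors_add_sum:
  assumes "c \<in> null_vectors R E A" and "\<And>i. i \<in> I \<Longrightarrow> d i \<in> null_vectors R E A"
  shows "(\<lambda>e. c e + (\<Sum>i \<in> I. k i * d i e)) \<in> null_vectors R E A"
proof -
  have "(\<Sum>e \<in> E. (c e + (\<Sum>i \<in> I. k i * d i e)) * A r e) = 0" if r: "r \<in> R" for r
  proof -
    have "(\<Sum>e \<in> E. (\<Sum>i \<in> I. k i * d i e) * A r e) = (\<Sum>e \<in> E. \<Sum>i \<in> I. k i * (d i e * A r e))"
      by (simp add: sum_distrib_right mult.assoc)
    also have "\<dots> = (\<Sum>i \<in> I. k i * (\<Sum>e \<in> E. d i e * A r e))"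
      by (subst sum.swap) (simp add: sum_distrib_left)
    also have "\<dots> = 0"
      using assms(2) r by (intro sum.neutral) (auto simp: null_vectors_def)
    finally show ?thesis
      using assms(1) r by (simp add: distrib_right sum.distrib null_vectors_def)
  qed
  then show ?thesis by (simp add: null_vectors_def)
qed

lemma basis_of_exists:
  assumes "finite X" "indep M {}"
  shows "\<exists>B. basis_of M X B"
proof -
  let ?S = "{B. B \<subseteq> X \<and> indep M B}"
  have "finite ?S" "?S \<noteq> {}" using assms by auto
  then obtain B where B: "B \<in> ?S" and max: "\<forall>b \<in> ?S. B \<subseteq> b \<longrightarrow> B = b"
    using finite_has_maximal[of ?S] by blast
  have "\<not> indep M (insert x B)" if "x \<in> X - B" for x
    using B max that by blast
  with B show ?thesis unfolding basis_of_def by blast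
qed

text \<open>For a basis \<open>B\<close> of \<open>C\<close>, fundamental circuits move the support
  of a dependency from \<open>X \<union> C\<close> into \<open>X \<union> B\<close> without changing
  it on \<open>X\<close>. Conversely, a dependency on \<open>X \<union> B\<close> that vanishes on
  \<open>X\<close> lives on \<open>B\<close> and so is zero. The criterion no longer mentions
  \<open>B\<close>.\<close>

lemma indep_contract_vector_matroid:
  assumes fin: "finite E" and C: "C \<subseteq> E"
  shows "indep (matroid_contract (vector_matroid R E A) C) X \<longleftrightarrow>
    X \<subseteq> E - C \<and>
    (\<forall>c \<in> null_vectors R E A. (\<forall>e. e \<notin> X \<union> C \<longrightarrow> c e = 0) \<longrightarrow> (\<forall>e \<in> X. c e = 0))"
proof (cases "X \<subseteq> E - C")
  case X: True
  let ?M = "vector_matroid R E A" and ?N = "null_vectors R E A"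
  have indep_iff: "indep ?M Y \<longleftrightarrow> Y \<subseteq> E \<and>
      (\<forall>c \<in> ?N. (\<forall>e. e \<notin> Y \<longrightarrow> c e = 0) \<longrightarrow> (\<forall>e \<in> Y. c e = 0))" for Y
    using columns_independent_iff[OF fin] by (auto simp: vector_matroid_def)
  have contract_iff: "indep (matroid_contract ?M C) X \<longleftrightarrow>
      (\<exists>B. basis_of ?M C B \<and> indep ?M (X \<union> B))"
    using X C by (simp add: matroid_contract_def vector_matroid_def Int_absorb1)
  show ?thesis
  proof
    assume "indep (matroid_contract ?M C) X"
    then obtain B where B: "basis_of ?M C B" and XB: "indep ?M (X \<union> B)"
      using contract_iff by blast
    \<comment> \<open>The vector \<open>d\<close> is the fundamental circuit of \<open>e\<close>
      with respect to \<open>B\<close>; its entry at \<open>e\<close> is nonzero because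
      \<open>B\<close> itself carries no dependency.\<close>
    have "\<exists>d \<in> ?N. d e = 1 \<and> (\<forall>u. u \<notin> insert e B \<longrightarrow> d u = 0)" if e: "e \<in> C - B" for e
    proof -
      have "\<not> indep ?M (insert e B)" using B e by (simp add: basis_of_def)
      then obtain d where d: "d \<in> ?N" "\<forall>u. u \<notin> insert e B \<longrightarrow> d u = 0"
        and nz: "\<exists>u \<in> insert e B. d u \<noteq> 0"
        using B e C unfolding indep_iff basis_of_def by blast
      have "d e \<noteq> 0"
      proof
        assume "d e = 0"
        with d have "\<forall>u. u \<notin> B \<longrightarrow> d u = 0" by (metis insertE)
        then have "\<forall>u \<in> B. d u = 0"
          using B d(1) unfolding indep_iff basis_of_def by blast
        with nz \<open>d e = 0\<close> show False by blast
      qed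
      then show ?thesis using d by auto
    qed
    then obtain d where d: "\<And>e. e \<in> C - B \<Longrightarrow> d e \<in> ?N" "\<And>e. e \<in> C - B \<Longrightarrow> d e e = 1"
      "\<And>e u. e \<in> C - B \<Longrightarrow> u \<notin> insert e B \<Longrightarrow> d e u = 0"
      by metis
    have "c x = 0" if c: "c \<in> ?N" and supp: "\<forall>e. e \<notin> X \<union> C \<longrightarrow> c e = 0" and x: "x \<in> X" for c x
    proof -
      \<comment> \<open>Clear the entries of \<open>c\<close> in \<open>C - B\<close> by adding the fundamental circuits of \<open>B\<close>.\<close>
      let ?c = "\<lambda>u. c u + (\<Sum>e \<in> C - B. c e * d e u)"
      have "?c \<in> ?N" using c d(1) by (rule null_vectors_add_sum)
      moreover have "?c u = 0" if u: "u \<notin> X \<union> B" for u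
      proof (cases "u \<in> C")
        case True
        have "(\<Sum>e \<in> C - B. c e * d e u) = (\<Sum>e \<in> C - B. if e = u then c u else 0)"
        proof (rule sum.cong[OF refl])
          fix e assume e: "e \<in> C - B"
          show "c e * d e u = (if e = u then c u else 0)"
            using d(2)[OF e] d(3)[OF e, of u] u by auto
        qed
        also have "\<dots> = c u"
          using True u finite_subset[OF C fin] by simp
        finally show ?thesis by simp
      next
        case False
        have "d e u = 0" if "e \<in> C - B" for e
          using d(3)[OF that, of u] that False u by blast
        then have "(\<Sum>e \<in> C - B. c e * d e u) = 0" by simp
        then show ?thesis using False supp u by simp
      qed
      ultimately have "?c x = 0" using XB x unfolding indep_iff by blast
      moreover have "d e x = 0" if "e \<in> C - B" for e
        using d(3)[OF that, of x] that X B x by (auto simp: basis_of_def)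
      ultimately show ?thesis by simp
    qed
    then show "X \<subseteq> E - C \<and> (\<forall>c \<in> ?N. (\<forall>e. e \<notin> X \<union> C \<longrightarrow> c e = 0) \<longrightarrow> (\<forall>e \<in> X. c e = 0))"
      using X by blast
  next
    assume R: "X \<subseteq> E - C \<and> (\<forall>c \<in> ?N. (\<forall>e. e \<notin> X \<union> C \<longrightarrow> c e = 0) \<longrightarrow> (\<forall>e \<in> X. c e = 0))"
    have "indep ?M {}" by (simp add: indep_iff)
    then obtain B where B: "basis_of ?M C B"
      using basis_of_exists finite_subset[OF C fin] by blast
    have "indep ?M (X \<union> B)"
      unfolding indep_iff
    proof (intro conjI ballI impI)
      show "X \<union> B \<subseteq> E" using R B C by (auto simp: basis_of_def)
      fix c e assume c: "c \<in> ?N" and supp: "\<forall>e. e \<notin> X \<union> B \<longrightarrow> c e = 0" and e: "e \<in> X \<union> B"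
      have "\<forall>e. e \<notin> X \<union> C \<longrightarrow> c e = 0" using supp B by (auto simp: basis_of_def)
      then have X0: "\<forall>e \<in> X. c e = 0" using R c by blast
      with supp have "\<forall>e. e \<notin> B \<longrightarrow> c e = 0" by blast
      then have "\<forall>e \<in> B. c e = 0" using B c unfolding basis_of_def indep_iff by blast
      with X0 e show "c e = 0" by blast
    qed
    with B show "indep (matroid_contract ?M C) X" using contract_iff by blast
  qed
qed (simp add: matroid_contract_def vector_matroid_def)


section \<open>Null vectors of isotropic matroids\<close>

lemma UNIV_ias_block: "UNIV = {Phi, Chi, Psi}"
  using ias_block.exhaust by auto

lemma Union_cells: "(\<Union>v \<in> W. cell v) = W \<times> UNIV"
  by (auto simp: cell_def UNIV_ias_block)

text \<open>The equation (I | A | I + A) c = 0 with the identity part moved to the left. A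
  \<open>Psi\<close> entry contributes to both sides.\<close>

definition ias_null :: "'v pair_pre_digraph \<Rightarrow> ('v \<times> ias_block \<Rightarrow> bit) set" where
  "ias_null G = {c. \<forall>u \<in> pverts G. c (u, Phi) + c (u, Psi) =
    (\<Sum>v \<in> pverts G. (c (v, Chi) + c (v, Psi)) * adjacency_matrix G u v)}"

lemma null_vectors_ias_matrix:
  assumes "finite (pverts G)"
  shows "null_vectors (pverts G) (pverts G \<times> UNIV) (ias_matrix G) = ias_null G"
proof -
  let ?V = "pverts G" and ?A = "adjacency_matrix G"
  have "(\<Sum>e \<in> ?V \<times> UNIV. c e * ias_matrix G u e) =
      c (u, Phi) + c (u, Psi) + (\<Sum>v \<in> ?V. (c (v, Chi) + c (v, Psi)) * ?A u v)"
    if u: "u \<in> ?V" for c u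
  proof -
    have "(\<Sum>e \<in> ?V \<times> UNIV. c e * ias_matrix G u e) =
        (\<Sum>v \<in> ?V. \<Sum>b \<in> UNIV. c (v, b) * ias_matrix G u (v, b))"
      by (simp add: sum.cartesian_product)
    also have "\<dots> = (\<Sum>v \<in> ?V. (if u = v then c (v, Phi) + c (v, Psi) else 0) +
        (c (v, Chi) + c (v, Psi)) * ?A u v)"
      by (intro sum.cong)
        (auto simp: UNIV_ias_block identity_matrix_def distrib_left distrib_right add_ac)
    finally show ?thesis using assms u by (simp add: sum.distrib)
  qed
  then show ?thesis by (auto simp: null_vectors_def ias_null_def bit_add_eq_0_iff)
qed

lemma ground_remove_cells:
  "W \<subseteq> pverts G \<Longrightarrow> ground (remove_cells (ias_matroid G) W t) = (pverts G - W) \<times> UNIV"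
  by (auto simp: remove_cells_def matroid_delete_def matroid_contract_def ias_matroid_def
      vector_matroid_def Union_cells cell_def UNIV_ias_block)

text \<open>Deletion only shrinks the ground set, so the contraction criterion applies with the
  transversal of the cells of \<open>W\<close> chosen by \<open>t\<close>. Vertex and block are
  quantified separately to let the blocks be permuted one cell at a time later.\<close>

lemma indep_remove_cells:
  assumes fin: "finite (pverts G)" and W: "W \<subseteq> pverts G"
  shows "indep (remove_cells (ias_matroid G) W t) X \<longleftrightarrow> X \<subseteq> (pverts G - W) \<times> UNIV \<and>
    (\<forall>c \<in> ias_null G. (\<forall>v b. (v, b) \<notin> X \<longrightarrow> v \<notin> W \<or> b \<noteq> t v \<longrightarrow> c (v, b) = 0) \<longrightarrow>
      (\<forall>e \<in> X. c e = 0))"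
proof -
  let ?C = "{(v, t v) | v. v \<in> W}" and ?E = "pverts G \<times> (UNIV :: ias_block set)"
  let ?M = "vector_matroid (pverts G) ?E (ias_matrix G)"
  have supp: "(\<forall>e. e \<notin> X \<union> ?C \<longrightarrow> c e = 0) \<longleftrightarrow>
      (\<forall>v b. (v, b) \<notin> X \<longrightarrow> v \<notin> W \<or> b \<noteq> t v \<longrightarrow> c (v, b) = 0)" for c :: "_ \<Rightarrow> bit"
    by auto
  have "ground (matroid_contract ?M ?C) - (\<Union>v \<in> W. cell v - {(v, t v)}) = (pverts G - W) \<times> UNIV"
    by (auto simp: matroid_contract_def vector_matroid_def cell_def UNIV_ias_block)
  then have "indep (remove_cells (ias_matroid G) W t) X \<longleftrightarrow>
      X \<subseteq> (pverts G - W) \<times> UNIV \<and> indep (matroid_contract ?M ?C) X"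
    by (simp add: remove_cells_def matroid_delete_def ias_matroid_def Union_cells)
  also have "\<dots> \<longleftrightarrow> X \<subseteq> (pverts G - W) \<times> UNIV \<and>
      (\<forall>c \<in> ias_null G. (\<forall>e. e \<notin> X \<union> ?C \<longrightarrow> c e = 0) \<longrightarrow> (\<forall>e \<in> X. c e = 0))"
  proof -
    have "finite ?E" using fin by (simp add: UNIV_ias_block)
    moreover have "?C \<subseteq> ?E" using W by auto
    ultimately show ?thesis
      by (subst indep_contract_vector_matroid)
        (auto simp: null_vectors_ias_matrix[OF fin])
  qed
  finally show ?thesis unfolding supp .
qed

lemma indep_system_eqI:
  "ground M = ground N \<Longrightarrow> (\<And>X. indep M X \<longleftrightarrow> indep N X) \<Longrightarrow> M = (N :: 'a indep_system)"
  by (rule indep_system.equality) auto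

lemma remove_cells_empty:
  assumes "finite (pverts G)"
  shows "remove_cells (ias_matroid G) {} t = ias_matroid G"
proof (rule indep_system_eqI)
  show "ground (remove_cells (ias_matroid G) {} t) = ground (ias_matroid G)"
    by (subst ground_remove_cells) (auto simp: ias_matroid_def vector_matroid_def Union_cells)
  fix X
  have "finite (pverts G \<times> (UNIV :: ias_block set))"
    using assms by (simp add: UNIV_ias_block)
  then show "indep (remove_cells (ias_matroid G) {} t) X \<longleftrightarrow> indep (ias_matroid G) X"
    using assms
    by (subst indep_remove_cells)
      (auto simp: ias_matroid_def vector_matroid_def Union_cells columns_independent_iff
        null_vectors_ias_matrix)
qed


section \<open>Vertex deletion\<close>

lemma pverts_delete_vertex [simp]: "pverts (delete_vertex G v) = pverts G - {v}"
  by (simp add: delete_vertex_def)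

lemma adjacency_delete_vertex:
  "u \<noteq> v \<Longrightarrow> w \<noteq> v \<Longrightarrow> adjacency_matrix (delete_vertex G v) u w = adjacency_matrix G u w"
  by (simp add: delete_vertex_def adjacency_matrix_def)

text \<open>Under \<open>zero\<close> the columns of \<open>v\<close> contribute nothing to the
  sums, so the conditions for the smaller graph are those of \<open>G\<close> in all rows except
  \<open>v\<close>.\<close>

lemma ias_null_delete_vertex_iff:
  assumes fin: "finite (pverts G)" and v: "v \<in> pverts G"
    and zero: "c (v, Chi) + c (v, Psi) = 0"
  shows "c \<in> ias_null (delete_vertex G v) \<longleftrightarrow>
    (\<forall>u \<in> pverts G - {v}. c (u, Phi) + c (u, Psi) =
      (\<Sum>w \<in> pverts G. (c (w, Chi) + c (w, Psi)) * adjacency_matrix G u w))"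
proof -
  have "(\<Sum>w \<in> pverts G. (c (w, Chi) + c (w, Psi)) * adjacency_matrix G u w) =
      (\<Sum>w \<in> pverts G - {v}. (c (w, Chi) + c (w, Psi)) * adjacency_matrix G u w)" for u
    using zero by (simp add: sum.remove[OF fin v])
  then show ?thesis by (simp add: ias_null_def adjacency_delete_vertex)
qed

text \<open>The common frame of the two deletion lemmas below. A set \<open>X\<close> avoiding the
  cell of \<open>v\<close> only sees entries outside that cell, so it suffices that null vectors can
  be passed back and forth by changing entries of this cell alone.\<close>

lemma remove_cells_insert_eq_delete_vertexI:
  assumes fin: "finite (pverts G)" and v: "v \<in> pverts G" and W: "W \<subseteq> pverts G - {v}"
    and restrict: "\<And>c. c \<in> ias_null G \<Longrightarrow> (\<And>b. b \<noteq> t v \<Longrightarrow> c (v, b) = 0) \<Longrightarrow>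
      (\<lambda>e. if fst e = v then 0 else c e) \<in> ias_null (delete_vertex G v)"
    and extend: "\<And>c. c \<in> ias_null (delete_vertex G v) \<Longrightarrow> (\<And>b. c (v, b) = 0) \<Longrightarrow>
      \<exists>x. c((v, t v) := x) \<in> ias_null G"
  shows "remove_cells (ias_matroid G) (insert v W) t =
    remove_cells (ias_matroid (delete_vertex G v)) W t"
proof (rule indep_system_eqI)
  have vW: "v \<notin> W" "insert v W \<subseteq> pverts G" "W \<subseteq> pverts (delete_vertex G v)"
    "finite (pverts (delete_vertex G v))"
    using v W fin by auto
  have verts: "pverts (delete_vertex G v) - W = pverts G - insert v W" by auto
  show "ground (remove_cells (ias_matroid G) (insert v W) t) =
      ground (remove_cells (ias_matroid (delete_vertex G v)) W t)"
    using vW by (subst (1 2) ground_remove_cells) auto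
  fix X
  show "indep (remove_cells (ias_matroid G) (insert v W) t) X \<longleftrightarrow>
      indep (remove_cells (ias_matroid (delete_vertex G v)) W t) X"
  proof (cases "X \<subseteq> (pverts G - insert v W) \<times> UNIV")
    case X: True
    have "(\<forall>c \<in> ias_null G. (\<forall>u b. (u, b) \<notin> X \<longrightarrow> u \<notin> insert v W \<or> b \<noteq> t u \<longrightarrow> c (u, b) = 0) \<longrightarrow>
          (\<forall>e \<in> X. c e = 0)) \<longleftrightarrow>
        (\<forall>c \<in> ias_null (delete_vertex G v).
          (\<forall>u b. (u, b) \<notin> X \<longrightarrow> u \<notin> W \<or> b \<noteq> t u \<longrightarrow> c (u, b) = 0) \<longrightarrow> (\<forall>e \<in> X. c e = 0))"
      (is "?L \<longleftrightarrow> ?R")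
    proof
      assume L: ?L
      show ?R
      proof (intro ballI impI)
        fix c e
        assume c: "c \<in> ias_null (delete_vertex G v)" and e: "e \<in> X"
          and supp: "\<forall>u b. (u, b) \<notin> X \<longrightarrow> u \<notin> W \<or> b \<noteq> t u \<longrightarrow> c (u, b) = 0"
        have "c (v, b) = 0" for b using supp vW X by blast
        with extend[OF c] obtain x where x: "c((v, t v) := x) \<in> ias_null G" by blast
        have "\<forall>u b. (u, b) \<notin> X \<longrightarrow> u \<notin> insert v W \<or> b \<noteq> t u \<longrightarrow> (c((v, t v) := x)) (u, b) = 0"
          using supp by auto
        with L x e have "(c((v, t v) := x)) e = 0" by blast
        moreover have "e \<noteq> (v, t v)" using e X by auto
        ultimately show "c e = 0" by simp
      qed
    next
      assume R: ?R
      show ?L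
      proof (intro ballI impI)
        fix c e
        assume c: "c \<in> ias_null G" and e: "e \<in> X"
          and supp: "\<forall>u b. (u, b) \<notin> X \<longrightarrow> u \<notin> insert v W \<or> b \<noteq> t u \<longrightarrow> c (u, b) = 0"
        \<comment> \<open>The entry at \<open>(v, t v)\<close> must be cleared too: once
          \<open>v\<close> is deleted it is no longer a contracted element, and the support
          condition requires zero there.\<close>
        let ?d = "\<lambda>e. if fst e = v then 0 else c e"
        have "c (v, b) = 0" if "b \<noteq> t v" for b using supp X that by blast
        with restrict[OF c] have "?d \<in> ias_null (delete_vertex G v)" by blast
        moreover have "\<forall>u b. (u, b) \<notin> X \<longrightarrow> u \<notin> W \<or> b \<noteq> t u \<longrightarrow> ?d (u, b) = 0"
          using supp by auto
        ultimately have "\<forall>e \<in> X. ?d e = 0" by (rule bspec[OF R, THEN mp])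
        then have "?d e = 0" using e by (rule bspec)
        moreover have "fst e \<noteq> v" using e X by auto
        ultimately show "c e = 0" by simp
      qed
    qed
    then show ?thesis
      unfolding indep_remove_cells[OF fin vW(2)] indep_remove_cells[OF vW(4) vW(3)] verts
      by (simp only:)
  next
    case False
    then show ?thesis
      unfolding indep_remove_cells[OF fin vW(2)] indep_remove_cells[OF vW(4) vW(3)] verts
      by (simp only: simp_thms)
  qed
qed

text \<open>The column of \<open>(v, Phi)\<close> is the unit vector of row \<open>v\<close>: its
  entry occurs in no other row, and it can always be chosen to satisfy row \<open>v\<close>.\<close>

lemma remove_cells_insert_Phi:
  assumes "finite (pverts G)" "v \<in> pverts G" "W \<subseteq> pverts G - {v}" "t v = Phi"
  shows "remove_cells (ias_matroid G) (insert v W) t =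
    remove_cells (ias_matroid (delete_vertex G v)) W t"
proof (rule remove_cells_insert_eq_delete_vertexI[OF assms(1-3)])
  let ?A = "adjacency_matrix G"
  fix c
  {
    assume c: "c \<in> ias_null G" and "\<And>b. b \<noteq> t v \<Longrightarrow> c (v, b) = 0"
    then have cv: "c (v, Chi) = 0" "c (v, Psi) = 0" using assms(4) by simp_all
    have "(\<Sum>w \<in> pverts G. ((if w = v then 0 else c (w, Chi)) + (if w = v then 0 else c (w, Psi))) * ?A u w) =
        (\<Sum>w \<in> pverts G. (c (w, Chi) + c (w, Psi)) * ?A u w)" for u
      using cv by (intro sum.cong) auto
    then show "(\<lambda>e. if fst e = v then 0 else c e) \<in> ias_null (delete_vertex G v)"
      using assms(1,2) c by (subst ias_null_delete_vertex_iff) (simp_all add: ias_null_def)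
  next
    assume c: "c \<in> ias_null (delete_vertex G v)" and cv: "\<And>b. c (v, b) = 0"
    \<comment> \<open>The value that row \<open>v\<close> forces on the \<open>Phi\<close> entry
      when the \<open>Psi\<close> entry is zero.\<close>
    let ?x = "\<Sum>w \<in> pverts G. (c (w, Chi) + c (w, Psi)) * ?A v w"
    have "c((v, t v) := ?x) \<in> ias_null G"
      using c cv assms by (auto simp: ias_null_delete_vertex_iff) (simp add: ias_null_def)
    then show "\<exists>x. c((v, t v) := x) \<in> ias_null G" by blast
  }
qed

text \<open>Off the diagonal, row and column \<open>v\<close> of the adjacency matrix vanish. Hence
  the cell of \<open>v\<close> does not interact with the other rows, and zero entries on it satisfy
  row \<open>v\<close>, whichever element \<open>t v\<close> is contracted.\<close>

lemma remove_cells_insert_isolated: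
  assumes graph: "pair_pseudo_graph G" and v: "v \<in> pverts G" and W: "W \<subseteq> pverts G - {v}"
    and isolated: "nbrs G v = {}"
  shows "remove_cells (ias_matroid G) (insert v W) t =
    remove_cells (ias_matroid (delete_vertex G v)) W t"
proof -
  let ?A = "adjacency_matrix G"
  interpret pair_pseudo_graph G by (rule graph)
  have fin: "finite (pverts G)" by (rule pair_finite_verts)
  have A0: "?A u v = 0" "?A v u = 0" if "u \<noteq> v" for u
  proof -
    have "(v, u) \<notin> parcs G" using isolated that by (auto simp: nbrs_def)
    moreover have "(u, v) \<notin> parcs G"
      using calculation pair_sym_arcs by (auto simp: symmetric_def sym_def)
    ultimately show "?A u v = 0" "?A v u = 0" by (simp_all add: adjacency_matrix_def)
  qed
  show ?thesis
  proof (rule remove_cells_insert_eq_delete_vertexI[OF fin v W])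
    fix c
    {
      assume c: "c \<in> ias_null G"
      have "(\<Sum>w \<in> pverts G. ((if w = v then 0 else c (w, Chi)) + (if w = v then 0 else c (w, Psi))) * ?A u w) =
          (\<Sum>w \<in> pverts G. (c (w, Chi) + c (w, Psi)) * ?A u w)" if "u \<noteq> v" for u
        using A0 that by (intro sum.cong) auto
      then show "(\<lambda>e. if fst e = v then 0 else c e) \<in> ias_null (delete_vertex G v)"
        using fin v c by (subst ias_null_delete_vertex_iff) (simp_all add: ias_null_def)
    next
      assume c: "c \<in> ias_null (delete_vertex G v)" and cv: "\<And>b. c (v, b) = 0"
      have "(\<Sum>w \<in> pverts G. (c (w, Chi) + c (w, Psi)) * ?A v w) = 0"
      proof (rule sum.neutral, rule ballI)
        fix w show "(c (w, Chi) + c (w, Psi)) * ?A v w = 0"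
          using cv A0 by (cases "w = v") auto
      qed
      then have "c \<in> ias_null G"
        using c cv fin v by (subst (asm) ias_null_delete_vertex_iff) (auto simp: ias_null_def)
      moreover have "c((v, t v) := 0) = c" using cv by auto
      ultimately show "\<exists>x. c((v, t v) := x) \<in> ias_null G" by metis
    }
  qed
qed


section \<open>Permuting the elements of each cell\<close>

definition on_cells :: "('v \<Rightarrow> 'b \<Rightarrow> 'b) \<Rightarrow> 'v \<times> 'b \<Rightarrow> 'v \<times> 'b" where
  "on_cells p = (\<lambda>(v, b). (v, p v b))"

text \<open>Stated for null spaces rather than for matroids, since the null space determines
  independence after every removal of cells. Bijectivity at all \<open>v\<close> makes
  \<open>on_cells p\<close> a bijection of the whole type.\<close>

definition cell_iso ::
  "('v \<Rightarrow> ias_block \<Rightarrow> ias_block) \<Rightarrow> 'v pair_pre_digraph \<Rightarrow> 'v pair_pre_digraph \<Rightarrow> bool"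
where
  "cell_iso p G H \<longleftrightarrow> (\<forall>v. bij (p v)) \<and> pverts H = pverts G \<and>
    (\<forall>c. c \<in> ias_null H \<longleftrightarrow> c \<circ> on_cells p \<in> ias_null G)"

lemma cell_iso_trans:
  assumes "cell_iso p G H" "cell_iso q H K"
  shows "cell_iso (\<lambda>v. q v \<circ> p v) G K"
proof -
  have "on_cells (\<lambda>v. q v \<circ> p v) = on_cells q \<circ> on_cells p"
    by (auto simp: on_cells_def)
  then show ?thesis using assms by (auto simp: cell_iso_def bij_comp comp_assoc)
qed

text \<open>The map \<open>on_cells p\<close> carries the contracted element \<open>(v, t v)\<close>
  to \<open>(v, p v (t v))\<close>, and pulling null vectors back along it turns the support
  conditions for \<open>H\<close> into those for \<open>G\<close>.\<close>

lemma matroid_iso_remove_cells: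
  assumes iso: "cell_iso p G H" and fin: "finite (pverts G)" and W: "W \<subseteq> pverts G"
  shows "matroid_iso (remove_cells (ias_matroid G) W t)
    (remove_cells (ias_matroid H) W (\<lambda>v. p v (t v)))"
    (is "matroid_iso ?M ?N")
proof -
  let ?f = "on_cells p"
  have bij: "\<And>v. bij (p v)" and V: "pverts H = pverts G"
    and null: "\<And>c. c \<in> ias_null H \<longleftrightarrow> c \<circ> ?f \<in> ias_null G"
    using iso by (auto simp: cell_iso_def)
  have inj_p: "p v a = p v b \<longleftrightarrow> a = b" for v a b
    using bij by (simp add: bij_def inj_eq)
  have bij_f: "bij ?f"
  proof (rule o_bij)
    show "on_cells (\<lambda>v. inv (p v)) \<circ> ?f = id"
      using bij by (auto simp: on_cells_def bij_def)
    show "?f \<circ> on_cells (\<lambda>v. inv (p v)) = id"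
      using bij by (auto simp: on_cells_def bij_def surj_f_inv_f)
  qed
  have img: "?f ` (U \<times> UNIV) = U \<times> UNIV" for U
  proof -
    have "(v, b) \<in> ?f ` (U \<times> UNIV)" if "v \<in> U" for v b
      using that bij[of v] by (auto simp: on_cells_def image_iff bij_def dest: surjD)
    then show ?thesis by (auto simp: on_cells_def)
  qed
  have ground: "ground ?M = (pverts G - W) \<times> UNIV" "ground ?N = (pverts G - W) \<times> UNIV"
    using W V by (auto simp: ground_remove_cells)
  have "bij_betw ?f (ground ?M) (ground ?N)"
    unfolding ground using bij_f img by (auto simp: bij_betw_def bij_def intro: inj_on_subset)
  moreover have "indep ?M X \<longleftrightarrow> indep ?N (?f ` X)" if X: "X \<subseteq> ground ?M" for X
  proof -
    let ?P = "\<lambda>c. (\<forall>v b. (v, b) \<notin> X \<longrightarrow> v \<notin> W \<or> b \<noteq> t v \<longrightarrow> c (v, b) = 0) \<longrightarrow>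
      (\<forall>e \<in> X. c e = 0)"
    let ?Q = "\<lambda>c. (\<forall>v b. (v, b) \<notin> ?f ` X \<longrightarrow> v \<notin> W \<or> b \<noteq> p v (t v) \<longrightarrow> c (v, b) = 0) \<longrightarrow>
      (\<forall>e \<in> ?f ` X. c e = 0)"
    have mem: "(v, p v b) \<in> ?f ` X \<longleftrightarrow> (v, b) \<in> X" for v b
      by (force simp: on_cells_def image_iff inj_p)
    \<comment> \<open>Reindexes the blocks of one cell along the bijection
      \<open>p v\<close>.\<close>
    have all_p: "(\<forall>b. S b) \<longleftrightarrow> (\<forall>b. S (p v b))" for S v
      using bij[of v] by (metis bij_pointE)
    have QP: "?Q c \<longleftrightarrow> ?P (c \<circ> ?f)" for c :: "_ \<Rightarrow> bit"
    proof -
      have "(\<forall>b. (v, b) \<notin> ?f ` X \<longrightarrow> v \<notin> W \<or> b \<noteq> p v (t v) \<longrightarrow> c (v, b) = 0) \<longleftrightarrow>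
          (\<forall>b. (v, b) \<notin> X \<longrightarrow> v \<notin> W \<or> b \<noteq> t v \<longrightarrow> (c \<circ> ?f) (v, b) = 0)" for v
        by (subst all_p[of _ v]) (simp add: mem inj_p, simp add: on_cells_def)
      then show ?thesis by simp
    qed
    have "(\<forall>c \<in> ias_null H. ?Q c) \<longleftrightarrow> (\<forall>c \<in> ias_null G. ?P c)"
    proof
      assume L: "\<forall>c \<in> ias_null H. ?Q c"
      show "\<forall>c \<in> ias_null G. ?P c"
      proof
        fix c assume c: "c \<in> ias_null G"
        \<comment> \<open>Every null vector of \<open>G\<close> is the pullback of one of
          \<open>H\<close>, namely of \<open>c \<circ> inv ?f\<close>.\<close>
        have eq: "(c \<circ> inv ?f) \<circ> ?f = c"
          using bij_f by (simp add: comp_assoc bij_def)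
        then have "c \<circ> inv ?f \<in> ias_null H" using c null by metis
        with L have "?Q (c \<circ> inv ?f)" by blast
        then show "?P c" unfolding QP eq .
      qed
    next
      assume "\<forall>c \<in> ias_null G. ?P c"
      then show "\<forall>c \<in> ias_null H. ?Q c" unfolding QP using null by blast
    qed
    moreover have "?f ` X \<subseteq> (pverts G - W) \<times> UNIV"
      using X unfolding ground by (auto simp: on_cells_def)
    ultimately show ?thesis
      using X W fin V unfolding ground by (simp add: indep_remove_cells)
  qed
  ultimately show ?thesis unfolding matroid_iso_def by blast
qed


section \<open>Local operations as cell permutations\<close>

lemma pair_pseudo_graph_iff:
  "pair_pseudo_graph G \<longleftrightarrow>
    finite (pverts G) \<and> parcs G \<subseteq> pverts G \<times> pverts G \<and> sym (parcs G)"
proof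
  assume "pair_pseudo_graph G"
  then interpret pair_pseudo_graph G .
  show "finite (pverts G) \<and> parcs G \<subseteq> pverts G \<times> pverts G \<and> sym (parcs G)"
    using pair_finite_verts in_arcsD1 in_arcsD2 pair_sym_arcs by (auto simp: symmetric_def)
next
  assume "finite (pverts G) \<and> parcs G \<subseteq> pverts G \<times> pverts G \<and> sym (parcs G)"
  then show "pair_pseudo_graph G"
    by unfold_locales (auto simp: symmetric_def intro: finite_subset)
qed

lemma sym_diff_sym: "sym R \<Longrightarrow> sym S \<Longrightarrow> sym (sym_diff R S)"
  by (auto simp: sym_def)

lemma pair_pseudo_graph_toggle:
  assumes "pair_pseudo_graph G" "F \<subseteq> pverts G \<times> pverts G" "sym F"
  shows "pair_pseudo_graph (toggle G F)"
  using assms by (auto simp: pair_pseudo_graph_iff toggle_def intro!: sym_diff_sym)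

lemma pverts_toggle [simp]: "pverts (toggle G F) = pverts G"
  by (simp add: toggle_def)

lemma adjacency_toggle:
  "adjacency_matrix (toggle G F) u w = adjacency_matrix G u w + of_bool ((u, w) \<in> F)"
  by (auto simp: adjacency_matrix_def toggle_def)

lemma nbrs_subset: "pair_pseudo_graph G \<Longrightarrow> nbrs G v \<subseteq> pverts G"
  by (auto simp: nbrs_def pair_pseudo_graph_iff)

lemma pair_pseudo_graph_step:
  assumes "graph_step G H" "pair_pseudo_graph G"
  shows "pair_pseudo_graph H"
  using assms
proof cases
  case (simple v)
  then show ?thesis
    using assms(2) nbrs_subset[OF assms(2), of v]
    by (auto simp: simple_local_complement_def sym_def intro!: pair_pseudo_graph_toggle)
next
  case (nonsimple v)
  then show ?thesis
    using assms(2) nbrs_subset[OF assms(2), of v]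
    by (auto simp: nonsimple_local_complement_def simple_local_complement_def sym_def
        intro!: pair_pseudo_graph_toggle)
next
  case (loop v)
  then show ?thesis
    using assms(2) by (auto simp: loop_complement_def sym_def intro!: pair_pseudo_graph_toggle)
next
  case (delete v)
  then show ?thesis
    using assms(2) by (auto simp: delete_vertex_def pair_pseudo_graph_iff sym_def)
qed

text \<open>The off-diagonal and diagonal toggles are disjoint and fill the square of the
  neighborhood, so the adjacency matrix changes by a matrix of rank at most one.\<close>

lemma nonsimple_local_complement_eq:
  "nonsimple_local_complement G v = toggle G (nbrs G v \<times> nbrs G v)"
  by (auto simp: nonsimple_local_complement_def simple_local_complement_def toggle_def)

text \<open>A set \<open>U\<close> is allowed because a simple local complementation affects the
  cells of all neighbors at once.\<close>

definition cell_transpose :: "'v set \<Rightarrow> 'b \<Rightarrow> 'b \<Rightarrow> 'v \<Rightarrow> 'b \<Rightarrow> 'b" where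
  "cell_transpose U a b = (\<lambda>u. if u \<in> U then transpose a b else id)"

lemma bij_cell_transpose: "bij (cell_transpose U a b v)"
  by (simp add: cell_transpose_def)

text \<open>Reversing the loop at \<open>u\<close> adds the unit vector of \<open>u\<close> to
  column \<open>u\<close> of the adjacency matrix, which exchanges the \<open>Chi\<close> and
  \<open>Psi\<close> columns.\<close>

lemma cell_iso_toggle_loops:
  assumes fin: "finite (pverts G)"
  shows "cell_iso (cell_transpose U Chi Psi) G (toggle G {(u, u) | u. u \<in> U})"
    (is "cell_iso ?p G ?H")
proof -
  have "c \<in> ias_null ?H \<longleftrightarrow> c \<circ> on_cells ?p \<in> ias_null G" for c
  proof -
    let ?d = "c \<circ> on_cells ?p" and ?A = "adjacency_matrix G"
    let ?y = "\<lambda>v. c (v, Chi) + c (v, Psi)"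
    have "(\<Sum>v \<in> pverts G. ?y v * adjacency_matrix ?H u v) =
        (\<Sum>v \<in> pverts G. ?y v * ?A u v) + (if u \<in> U then ?y u else 0)" if "u \<in> pverts G" for u
    proof -
      have "(\<Sum>v \<in> pverts G. ?y v * adjacency_matrix ?H u v) =
          (\<Sum>v \<in> pverts G. ?y v * ?A u v + (if v = u then if u \<in> U then ?y u else 0 else 0))"
        by (intro sum.cong) (auto simp: adjacency_toggle distrib_left)
      also have "\<dots> = (\<Sum>v \<in> pverts G. ?y v * ?A u v) + (if u \<in> U then ?y u else 0)"
        using fin that by (simp add: sum.distrib del: if_cancel)
      finally show ?thesis .
    qed
    moreover have "?d (u, Chi) + ?d (u, Psi) = ?y u" for u
      by (simp add: on_cells_def cell_transpose_def add.commute)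
    \<comment> \<open>The swap adds \<open>?y u\<close> to the left side of row \<open>u\<close>,
      matching the diagonal term gained on the right.\<close>
    moreover have "(?d (u, Phi) + ?d (u, Psi) = s) =
        (c (u, Phi) + c (u, Psi) = s + (if u \<in> U then ?y u else 0))" for u s
      by (cases "c (u, Phi)"; cases "c (u, Chi)"; cases "c (u, Psi)"; cases s)
        (simp_all add: on_cells_def cell_transpose_def)
    ultimately show ?thesis by (simp add: ias_null_def)
  qed
  then show ?thesis by (simp add: cell_iso_def bij_cell_transpose)
qed

lemma cell_iso_loop_complement:
  "finite (pverts G) \<Longrightarrow> cell_iso (cell_transpose {v} Chi Psi) G (loop_complement G v)"
  using cell_iso_toggle_loops[of G "{v}"] by (simp add: loop_complement_def)

text \<open>Writing \<open>x\<close> and \<open>y\<close> for the coordinates \<open>c \<phi> + c \<psi>\<close> and \<open>c \<chi> + c \<psi>\<close>, a null vector satisfies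
  \<open>x = A y\<close>. The complementation adds \<open>n n\<^sup>T\<close> to \<open>A\<close>, where \<open>n\<close> indicates the neighbors of \<open>v\<close>, and
  this is absorbed by adding \<open>n \<bullet> y\<close> to the coordinate of \<open>y\<close> at \<open>v\<close> and, if \<open>v\<close> is looped, to that
  of \<open>x\<close>.\<close>

lemma cell_iso_nonsimple_local_complement:
  assumes graph: "pair_pseudo_graph G" and v: "v \<in> pverts G"
  shows "cell_iso (cell_transpose {v} Phi (if (v, v) \<in> parcs G then Chi else Psi)) G
    (nonsimple_local_complement G v)"
    (is "cell_iso ?p G ?H")
proof -
  have fin: "finite (pverts G)" and sym: "sym (parcs G)"
    using graph by (auto simp: pair_pseudo_graph_iff)
  have "c \<in> ias_null ?H \<longleftrightarrow> c \<circ> on_cells ?p \<in> ias_null G" for c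
  proof -
    let ?V = "pverts G" and ?A = "adjacency_matrix G"
    define d where "d = c \<circ> on_cells ?p"
    define x y where "x = (\<lambda>u. c (u, Phi) + c (u, Psi))" and "y = (\<lambda>u. c (u, Chi) + c (u, Psi))"
    define x' y' where "x' = (\<lambda>u. d (u, Phi) + d (u, Psi))" and "y' = (\<lambda>u. d (u, Chi) + d (u, Psi))"
    define n :: "_ \<Rightarrow> bit" where "n = (\<lambda>u. of_bool (u \<in> nbrs G v))"
    define S where "S = (\<lambda>u. \<Sum>w \<in> ?V. y w * ?A u w)"
    define s where "s = (\<Sum>w \<in> ?V. y w * n w)"
    have nv: "n v = 0" by (simp add: n_def nbrs_def)
    have An: "?A u v = n u" "?A v u = n u" if "u \<noteq> v" for u
      using that sym by (auto simp: n_def nbrs_def adjacency_matrix_def sym_def)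
    have other: "x' u = x u" "y' u = y u" if "u \<noteq> v" for u
      using that
      by (simp_all add: x_def x'_def y_def y'_def d_def on_cells_def cell_transpose_def)
    have at_v: "x' v = (if (v, v) \<in> parcs G then y v else x v)"
      "y v + y' v = (if (v, v) \<in> parcs G then x v + y v else x v)"
      by (cases "c (v, Phi)"; cases "c (v, Chi)"; cases "c (v, Psi)";
          simp add: x_def x'_def y_def y'_def d_def on_cells_def cell_transpose_def)+
    have Avv: "?A v v = of_bool ((v, v) \<in> parcs G)" by (simp add: adjacency_matrix_def)
    have "(\<Sum>w \<in> ?V. y w * adjacency_matrix ?H u w) = S u + n u * s" for u
    proof -
      have "y w * adjacency_matrix ?H u w = y w * ?A u w + n u * (y w * n w)" for w
        by (simp add: nonsimple_local_complement_eq adjacency_toggle n_def distrib_left)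
      then show ?thesis by (simp add: S_def s_def sum.distrib sum_distrib_left)
    qed
    then have H: "c \<in> ias_null ?H \<longleftrightarrow> (\<forall>u \<in> ?V. x u = S u + n u * s)"
      by (simp add: ias_null_def nonsimple_local_complement_eq x_def y_def)
    have "(\<Sum>w \<in> ?V. y' w * ?A u w) = S u + (y v + y' v) * ?A u v" for u
    proof -
      have "(\<Sum>w \<in> ?V. y' w * ?A u w) = y' v * ?A u v + (\<Sum>w \<in> ?V - {v}. y w * ?A u w)"
        using other by (simp add: sum.remove[OF fin v])
      moreover have "S u = y v * ?A u v + (\<Sum>w \<in> ?V - {v}. y w * ?A u w)"
        by (simp add: S_def sum.remove[OF fin v])
      ultimately show ?thesis
        by (cases "y v"; cases "y' v"; cases "?A u v") simp_all
    qed
    then have G: "d \<in> ias_null G \<longleftrightarrow> (\<forall>u \<in> ?V. x' u = S u + (y v + y' v) * ?A u v)"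
      by (simp add: ias_null_def x'_def y'_def)
    \<comment> \<open>Off the diagonal, row \<open>v\<close> of the adjacency matrix is the
      indicator \<open>n\<close>, so \<open>s\<close> can be read from row \<open>v\<close>.\<close>
    have s: "s = S v + y v * ?A v v"
    proof -
      have "s = (\<Sum>w \<in> ?V - {v}. y w * ?A v w)"
        using nv An by (simp add: s_def sum.remove[OF fin v])
      moreover have "S v = y v * ?A v v + (\<Sum>w \<in> ?V - {v}. y w * ?A v w)"
        by (simp add: S_def sum.remove[OF fin v])
      ultimately show ?thesis by (simp add: add_ac)
    qed
    \<comment> \<open>Row \<open>v\<close> expresses the same condition on both sides. Given it,
      \<open>s\<close> equals the change \<open>y v + y' v\<close>, and since column
      \<open>v\<close> is \<open>n\<close> off the diagonal, all other rows agree as well.\<close>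
    have eq_v: "x' v = S v + (y v + y' v) * ?A v v \<longleftrightarrow> x v = S v"
      unfolding at_v Avv by (cases "x v"; cases "y v"; cases "S v"; simp)
    have s_eq: "s = y v + y' v" if "x v = S v"
      using that unfolding s Avv at_v by simp
    have "(\<forall>u \<in> ?V. x u = S u + n u * s) \<longleftrightarrow>
        x v = S v \<and> (\<forall>u \<in> ?V - {v}. x u = S u + n u * s)"
      using v nv by auto
    also have "\<dots> \<longleftrightarrow> x v = S v \<and> (\<forall>u \<in> ?V - {v}. x' u = S u + (y v + y' v) * ?A u v)"
      using s_eq other An by (auto simp: mult.commute)
    also have "\<dots> \<longleftrightarrow> (\<forall>u \<in> ?V. x' u = S u + (y v + y' v) * ?A u v)"
      using v eq_v by blast
    finally show ?thesis using H G by (simp add: d_def)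
  qed
  then show ?thesis
    by (simp add: cell_iso_def bij_cell_transpose nonsimple_local_complement_eq)
qed

text \<open>A simple complementation is a non-simple one followed by reversing the loops at the
  neighbors of \<open>v\<close> in the original graph.\<close>

lemma cell_iso_simple_local_complement:
  assumes "pair_pseudo_graph G" "v \<in> pverts G"
  shows "\<exists>p. cell_iso p G (simple_local_complement G v)"
proof -
  let ?H = "nonsimple_local_complement G v"
  have eq: "simple_local_complement G v = toggle ?H {(u, u) | u. u \<in> nbrs G v}"
    by (auto simp: nonsimple_local_complement_eq simple_local_complement_def toggle_def)
  have "finite (pverts ?H)"
    using assms by (simp add: nonsimple_local_complement_eq pair_pseudo_graph_iff)
  from cell_iso_trans[OF cell_iso_nonsimple_local_complement[OF assms] cell_iso_toggle_loops[OF this, of "nbrs G v"]]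
  show ?thesis unfolding eq by blast
qed

lemma graph_step_cases:
  assumes "graph_step G H" "pair_pseudo_graph G"
  obtains p where "cell_iso p G H"
  | v where "v \<in> pverts G" "H = delete_vertex G v"
  using assms
proof cases
  case (simple v)
  with assms(2) that(1) show ?thesis using cell_iso_simple_local_complement by metis
next
  case (nonsimple v)
  with assms(2) that(1) show ?thesis using cell_iso_nonsimple_local_complement by metis
next
  case (loop v)
  with assms(2) that(1) show ?thesis
    using cell_iso_loop_complement by (metis pair_pseudo_graph_iff)
next
  case (delete v)
  with that(2) show ?thesis by blast
qed


section \<open>Vertex minors and cell removal\<close>

text \<open>The first step of the sequence is peeled off, and the removal found for the later graph
  is pulled back through it: a permutation relabels \<open>t\<close>, a deletion adds one cell to
  \<open>W\<close>.\<close>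

lemma steps_imp_remove_cells:
  assumes "graph_step\<^sup>*\<^sup>* G H" "pair_pseudo_graph G"
  shows "\<exists>W t. W \<subseteq> pverts G \<and> matroid_iso (ias_matroid H) (remove_cells (ias_matroid G) W t)"
  using assms
proof (induction rule: converse_rtranclp_induct)
  case base
  have "matroid_iso (ias_matroid H) (remove_cells (ias_matroid H) {} (\<lambda>_. Phi))"
    using base by (simp add: matroid_iso_refl remove_cells_empty pair_pseudo_graph_iff)
  then show ?case by blast
next
  case (step G K)
  have fin: "finite (pverts G)" using step.prems by (simp add: pair_pseudo_graph_iff)
  obtain W t where W: "W \<subseteq> pverts K"
    and iso: "matroid_iso (ias_matroid H) (remove_cells (ias_matroid K) W t)"
    using step.IH pair_pseudo_graph_step[OF step.hyps(1) step.prems] by blast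
  from step.hyps(1) step.prems show ?case
  proof (cases rule: graph_step_cases)
    case (1 p)
    \<comment> \<open>The labels \<open>t\<close> refer to \<open>K\<close>, so they are carried
      back to \<open>G\<close> by the inverse permutations.\<close>
    let ?t = "\<lambda>v. inv (p v) (t v)"
    have "\<And>v. p v (?t v) = t v" and V: "pverts K = pverts G"
      using 1 by (auto simp: cell_iso_def bij_def surj_f_inv_f)
    then have "matroid_iso (remove_cells (ias_matroid G) W ?t) (remove_cells (ias_matroid K) W t)"
      using matroid_iso_remove_cells[OF 1 fin, of W ?t] W by simp
    then show ?thesis using iso W V matroid_iso_sym matroid_iso_trans by metis
  next
    case (2 v)
    \<comment> \<open>Deleting \<open>v\<close> means contracting its \<open>Phi\<close> element. As
      \<open>v\<close> is not in \<open>W\<close>, the change does not affect the cells already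
      removed.\<close>
    let ?t = "t(v := Phi)"
    have vW: "W \<subseteq> pverts G - {v}" using W 2 by simp
    have "remove_cells (ias_matroid G) (insert v W) ?t = remove_cells (ias_matroid K) W ?t"
      using remove_cells_insert_Phi[OF fin 2(1) vW] 2(2) by simp
    moreover have "remove_cells M W ?t = remove_cells M W t" for M :: "('a \<times> ias_block) indep_system"
    proof -
      have t: "?t u = t u" if "u \<in> W" for u using that vW by auto
      then have "{(u, ?t u) | u. u \<in> W} = {(u, t u) | u. u \<in> W}" by force
      moreover have "(\<Union>u \<in> W. cell u - {(u, ?t u)}) = (\<Union>u \<in> W. cell u - {(u, t u)})"
        using t by (intro SUP_cong) auto
      ultimately show ?thesis by (simp only: remove_cells_def)
    qed
    ultimately show ?thesis using iso vW 2(1)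
      by (intro exI[of _ "insert v W"]) (metis Diff_subset insert_subset subset_trans)
  qed
qed

text \<open>The block at \<open>v\<close> that a complementation at \<open>v\<close> exchanges with \<open>Phi\<close> depends on the loop
  status of \<open>v\<close>; complementing first at a neighbor of \<open>v\<close> changes that status and fixes the cell
  of \<open>v\<close>.\<close>

lemma move_to_Phi:
  assumes graph: "pair_pseudo_graph G" and v: "v \<in> pverts G" and nonisolated: "nbrs G v \<noteq> {}"
  shows "\<exists>H p. graph_step\<^sup>*\<^sup>* G H \<and> cell_iso p G H \<and> p v b = Phi"
proof -
  have local: "graph_step\<^sup>*\<^sup>* K (nonsimple_local_complement K v) \<and>
      cell_iso (cell_transpose {v} Phi b) K (nonsimple_local_complement K v) \<and>
      cell_transpose {v} Phi b v b = Phi"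
    if "pair_pseudo_graph K" "v \<in> pverts K" "b = (if (v, v) \<in> parcs K then Chi else Psi)" for K
    using that cell_iso_nonsimple_local_complement[of K v]
    by (auto simp: cell_transpose_def intro: graph_step.nonsimple)
  \<comment> \<open>The second alternative is the block that a complementation at \<open>v\<close>
    exchanges with \<open>Phi\<close>; the third is the remaining one.\<close>
  consider "b = Phi" | "b = (if (v, v) \<in> parcs G then Chi else Psi)"
    | "b = (if (v, v) \<in> parcs G then Psi else Chi)"
    by (cases b; cases "(v, v) \<in> parcs G"; simp)
  then show ?thesis
  proof cases
    case 1
    have "cell_iso (\<lambda>_. id) G G"
      by (auto simp: cell_iso_def on_cells_def comp_def)
    with 1 show ?thesis by (intro exI[of _ G] exI[of _ "\<lambda>_. id"]) simp
  next
    case 2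
    with local[OF graph v] show ?thesis by blast
  next
    case 3
    obtain w where w: "w \<in> nbrs G v" using nonisolated by blast
    then have w': "w \<in> pverts G" "v \<in> nbrs G w" "w \<noteq> v"
      using graph by (auto simp: pair_pseudo_graph_iff nbrs_def sym_def)
    let ?K = "nonsimple_local_complement G w"
    have step: "graph_step G ?K" using w'(1) by (rule graph_step.nonsimple)
    have K: "pair_pseudo_graph ?K" using step graph by (rule pair_pseudo_graph_step)
    obtain a where iso: "cell_iso (cell_transpose {w} Phi a) G ?K"
      using cell_iso_nonsimple_local_complement[OF graph w'(1)] by blast
    have "(v, v) \<in> parcs ?K \<longleftrightarrow> (v, v) \<notin> parcs G"
      using w'(2) by (auto simp: nonsimple_local_complement_eq toggle_def)
    with 3 have "b = (if (v, v) \<in> parcs ?K then Chi else Psi)" by simp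
    moreover have "v \<in> pverts ?K" using v by (simp add: nonsimple_local_complement_eq)
    ultimately have H: "graph_step\<^sup>*\<^sup>* ?K (nonsimple_local_complement ?K v)"
      "cell_iso (cell_transpose {v} Phi b) ?K (nonsimple_local_complement ?K v)"
      "cell_transpose {v} Phi b v b = Phi"
      using local[OF K] by blast+
    have "(cell_transpose {v} Phi b v \<circ> cell_transpose {w} Phi a v) b = Phi"
      using H(3) w'(3) by (simp add: cell_transpose_def)
    with cell_iso_trans[OF iso H(2)] converse_rtranclp_into_rtranclp[OF step H(1)]
    show ?thesis by (intro exI conjI) assumption+
  qed
qed

lemma pair_pseudo_graph_steps:
  "graph_step\<^sup>*\<^sup>* G H \<Longrightarrow> pair_pseudo_graph G \<Longrightarrow> pair_pseudo_graph H"
  by (induction rule: rtranclp_induct) (auto intro: pair_pseudo_graph_step)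

text \<open>Cells are removed one at a time, each by a vertex deletion after \<open>t v\<close> has
  been moved to \<open>Phi\<close> if \<open>v\<close> has a neighbor. Both \<open>G\<close> and
  \<open>t\<close> vary in the induction because this move alters the graph and the labels of the
  cells still to be removed.\<close>

lemma remove_cells_imp_steps:
  assumes "finite W" "W \<subseteq> pverts G" "pair_pseudo_graph G"
  shows "\<exists>H. graph_step\<^sup>*\<^sup>* G H \<and> matroid_iso (remove_cells (ias_matroid G) W t) (ias_matroid H)"
  using assms
proof (induction W arbitrary: G t rule: finite_induct)
  case empty
  show ?case
    using empty by (intro exI[of _ G]) (simp add: matroid_iso_refl remove_cells_empty pair_pseudo_graph_iff)
next
  case (insert v W)
  have v: "v \<in> pverts G" using insert.prems by simp
  \<comment> \<open>Here \<open>K\<close> is \<open>G\<close> after the move and \<open>s\<close>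
    the transported labels; equality of the vertex sets keeps \<open>W\<close> available for the
    induction hypothesis.\<close>
  have "\<exists>K s. graph_step\<^sup>*\<^sup>* G K \<and> pverts K = pverts G \<and>
      matroid_iso (remove_cells (ias_matroid G) (insert v W) t)
        (remove_cells (ias_matroid (delete_vertex K v)) W s)"
  proof (cases "nbrs G v = {}")
    case True
    have "W \<subseteq> pverts G - {v}" using insert by auto
    then have "remove_cells (ias_matroid G) (insert v W) t =
        remove_cells (ias_matroid (delete_vertex G v)) W t"
      using insert.prems(2) v True by (intro remove_cells_insert_isolated)
    then show ?thesis
      by (intro exI[of _ G] exI[of _ t]) (simp add: matroid_iso_refl)
  next
    case False
    then obtain K p where K: "graph_step\<^sup>*\<^sup>* G K" and iso: "cell_iso p G K" and p: "p v (t v) = Phi"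
      using move_to_Phi insert.prems(2) v by metis
    have V: "pverts K = pverts G" using iso by (simp add: cell_iso_def)
    have fin: "finite (pverts G)" using insert.prems(2) by (simp add: pair_pseudo_graph_iff)
    let ?s = "\<lambda>u. p u (t u)"
    have "remove_cells (ias_matroid K) (insert v W) ?s =
        remove_cells (ias_matroid (delete_vertex K v)) W ?s"
      using fin v p insert V by (intro remove_cells_insert_Phi) auto
    with matroid_iso_remove_cells[OF iso fin insert.prems(1), of t] K V
    show ?thesis by (intro exI[of _ K] exI[of _ ?s]) simp
  qed
  then obtain K s where K: "graph_step\<^sup>*\<^sup>* G K" "pverts K = pverts G"
    and iso: "matroid_iso (remove_cells (ias_matroid G) (insert v W) t)
        (remove_cells (ias_matroid (delete_vertex K v)) W s)"
    by blast
  have step: "graph_step K (delete_vertex K v)" using K v by (simp add: graph_step.delete)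
  have steps: "graph_step\<^sup>*\<^sup>* G (delete_vertex K v)" using K(1) step by simp
  moreover have "W \<subseteq> pverts (delete_vertex K v)" using insert K by auto
  ultimately obtain H where "graph_step\<^sup>*\<^sup>* (delete_vertex K v) H"
    "matroid_iso (remove_cells (ias_matroid (delete_vertex K v)) W s) (ias_matroid H)"
    using insert.IH pair_pseudo_graph_steps[OF steps insert.prems(2)] by blast
  then show ?case using steps iso matroid_iso_trans by (meson rtranclp_trans)
qed

theorem theorem39:
  fixes G :: "'v pair_pre_digraph" and M :: "'a indep_system"
  assumes "pair_pseudo_graph G" and "binary_matroid M"
  shows "(\<exists>H. graph_step\<^sup>*\<^sup>* G H \<and> matroid_iso M (ias_matroid H)) \<longleftrightarrow>
    (\<exists>W t. W \<subseteq> pverts G \<and> matroid_iso M (remove_cells (ias_matroid G) W t))"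
proof
  assume "\<exists>H. graph_step\<^sup>*\<^sup>* G H \<and> matroid_iso M (ias_matroid H)"
  then show "\<exists>W t. W \<subseteq> pverts G \<and> matroid_iso M (remove_cells (ias_matroid G) W t)"
    using steps_imp_remove_cells[OF _ assms(1)] matroid_iso_trans by metis
next
  assume "\<exists>W t. W \<subseteq> pverts G \<and> matroid_iso M (remove_cells (ias_matroid G) W t)"
  then obtain W t where W: "W \<subseteq> pverts G"
    and iso: "matroid_iso M (remove_cells (ias_matroid G) W t)"
    by blast
  have "finite W" using W assms(1) finite_subset by (auto simp: pair_pseudo_graph_iff)
  from remove_cells_imp_steps[OF this W assms(1)] iso
  show "\<exists>H. graph_step\<^sup>*\<^sup>* G H \<and> matroid_iso M (ias_matroid H)"
    using matroid_iso_trans by metis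
qed

end
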